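(* Let $X=\mathbb{R}^n$, let $(\mathrm{P})$ be the linear semi-infinite problem $\inf\langle x^*,x\rangle$ s.t. $\langle a_t^*,x\rangle\le b_t$, $t\in T$, let $\emptyset\ne\mathcal{H}\subset\mathcal{F}(T)$, and assume that $(\mathrm{P})$ is bounded, i.e. $\alpha:=\inf(\mathrm{P})\in\mathbb{R}$. Then the following statements are equivalent: (i) $-(x^*,\alpha)\in\mathcal{K}_{\mathcal{H}}$. (ii) $\mathcal{H}$-strong duality holds, i.e. $\alpha=\max(\mathrm{D}_{\mathcal{H}})$. (iii) $(\mathrm{D})$ is $\mathcal{H}$-reducible and zero $\mathcal{H}$-duality holds, i.e. $\alpha=\sup(\mathrm{D}_{\mathcal{H}})$ (entailing $\alpha=\sup(\mathrm{D})$). (iv) $(\mathrm{P})$ is $\mathcal{H}$-reducible. Moreover, if $\mathcal{H}$ is a directed covering family, then the following statement is also equivalent to the four mentioned statements: (v) $\alpha=\max(\mathrm{D})$ (usual strong duality).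
   Context: $T$ is an infinite index set; $x^*,a_t^*\in\mathbb{R}^n$ and $b_t\in\mathbb{R}$ for $t\in T$. $\mathcal{F}(T)$ is the family of all non-empty finite subsets of $T$. For non-empty $A$, $\operatorname{cone}(A):=\{\mu z:\mu\ge 0,\ z\in\operatorname{co}A\}$, where $\operatorname{co}$ is the convex hull. For $H\in\mathcal{F}(T)$: - $(\mathrm{P}_H)$: $\inf\langle x^*,x\rangle$ s.t. $\langle a_t^*,x\rangle\le b_t$, $t\in H$. - $(\mathrm{D}_H)$: $\sup\,-\sum_{t\in H}\mu_tb_t$ s.t. $\mu\in\mathbb{R}_+^H$, $\sum_{t\in H}\mu_ta_t^*=-x^*$. - $(\mathrm{D}_{\mathcal{H}})$: $\sup\,-\sum_{t\in H}\mu_tb_t$ s.t. $H\in\mathcal{H}$, $\mu\in\mathbb{R}_+^H$, $\sum_{t\in H}\mu_ta_t^*=-x^*$. - $(\mathrm{D})$: $\sup\,-\sum_{t\in T}\lambda_tb_t$ s.t. $\lambda\in\mathbb{R}_+^{(T)}$, $\sum_{t\in T}\lambda_ta_t^*=-x^*$, where $\mathbb{R}_+^{(T)}$ is the set of finitely supported functions $\lambda:T\to\mathbb{R}_+$. (Supremum over the empty set is $-\infty$.) Writing $\max$ instead of $\sup$ means the supremum is attained. $\mathcal{K}_{\mathcal{H}}:=\bigcup_{H\in\mathcal{H}}\operatorname{cone}\left(\{(a_t^*,b_t):t\in H\}+\{0_n\}\times\mathbb{R}_+\right)\subset\mathbb{R}^n\times\mathbb{R}$. $(\mathrm{P})$ (resp.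 $(\mathrm{D})$) is $\mathcal{H}$-reducible if there exists $H\in\mathcal{H}$ such that $\inf(\mathrm{P})=\inf(\mathrm{P}_H)$ (resp. $\sup(\mathrm{D})=\sup(\mathrm{D}_H)$). $\mathcal{H}$ is covering if $\bigcup_{H\in\mathcal{H}}H=T$, and directed if for each $H,K\in\mathcal{H}$ there exists $L\in\mathcal{H}$ with $H\cup K\subset L$. *)

theory Defs
  imports "HOL-Analysis.Analysis"
begin

definition nonempty_finite_subsets :: "'i set \<Rightarrow> 'i set set" (\<open>\<F>\<close>) where
  "\<F> T = {H. H \<subseteq> T \<and> H \<noteq> {} \<and> finite H}"

definition covering :: "'i set \<Rightarrow> 'i set set \<Rightarrow> bool" where
  "covering T \<H> \<longleftrightarrow> \<Union>\<H> = T"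

definition directed :: "'i set set \<Rightarrow> bool" where
  "directed \<H> \<longleftrightarrow> (\<forall>H\<in>\<H>. \<forall>K\<in>\<H>. \<exists>L\<in>\<H>. H \<union> K \<subseteq> L)"

text \<open>The convex cone generated by a non-empty set. It always contains the origin.\<close>

definition gen_cone :: "'v::real_vector set \<Rightarrow> 'v set" where
  "gen_cone A = {\<mu> *\<^sub>R z | \<mu> z. 0 \<le> \<mu> \<and> z \<in> convex hull A}"

text \<open>The sum of sets below is the Minkowski sum.\<close>

definition K_cone :: "('i \<Rightarrow> real^'n) \<Rightarrow> ('i \<Rightarrow> real) \<Rightarrow> 'i set set \<Rightarrow> ((real^'n) \<times> real) set" where
  "K_cone a b \<H> = (\<Union>H\<in>\<H>. gen_cone ((\<lambda>t. (a t, b t)) ` H + {0} \<times> {0..}))"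

text \<open>
  Problem values are taken in the extended reals, so an infimum over the empty set is
  \<open>\<infinity>\<close> and a supremum over the empty set is \<open>-\<infinity>\<close>. The problem with constraints indexed by
  \<open>S\<close> serves both for \<open>(P)\<close> (\<open>S = T\<close>) and for \<open>(P\<^sub>H)\<close> (\<open>S = H\<close>).
  Throughout, \<open>c\<close> is the objective vector \<open>x\<^sup>*\<close>.
\<close>

definition primal_feasible :: "('i \<Rightarrow> real^'n) \<Rightarrow> ('i \<Rightarrow> real) \<Rightarrow> 'i set \<Rightarrow> (real^'n) set" where
  "primal_feasible a b S = {x. \<forall>t\<in>S. a t \<bullet> x \<le> b t}"

definition inf_P :: "real^'n \<Rightarrow> ('i \<Rightarrow> real^'n) \<Rightarrow> ('i \<Rightarrow> real) \<Rightarrow> 'i set \<Rightarrow> ereal" where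
  "inf_P c a b S = (INF x\<in>primal_feasible a b S. ereal (c \<bullet> x))"

text \<open>
  The sets of objective values of the dual problems \<open>(D\<^sub>H)\<close>, \<open>(D\<^sub>\<H>)\<close> and \<open>(D)\<close>. Only the
  restriction of \<open>\<mu>\<close> to \<open>H\<close> matters in the first one.
\<close>

definition DH_values :: "real^'n \<Rightarrow> ('i \<Rightarrow> real^'n) \<Rightarrow> ('i \<Rightarrow> real) \<Rightarrow> 'i set \<Rightarrow> real set" where
  "DH_values c a b H =
     {- (\<Sum>t\<in>H. \<mu> t * b t) | \<mu>. (\<forall>t\<in>H. 0 \<le> \<mu> t) \<and> (\<Sum>t\<in>H. \<mu> t *\<^sub>R a t) = - c}"

definition DF_values :: "real^'n \<Rightarrow> ('i \<Rightarrow> real^'n) \<Rightarrow> ('i \<Rightarrow> real) \<Rightarrow> 'i set set \<Rightarrow> real set" where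
  "DF_values c a b \<H> =
     {- (\<Sum>t\<in>H. \<mu> t * b t) | H \<mu>.
        H \<in> \<H> \<and> (\<forall>t\<in>H. 0 \<le> \<mu> t) \<and> (\<Sum>t\<in>H. \<mu> t *\<^sub>R a t) = - c}"

text \<open>
  Finitely supported non-negative functions on \<open>T\<close>, extended by zero outside \<open>T\<close>. Sums over
  \<open>T\<close> of such functions are written as sums over the (finite) support.
\<close>

definition supp :: "('i \<Rightarrow> real) \<Rightarrow> 'i set" where
  "supp l = {t. l t \<noteq> 0}"

definition fin_supp_nonneg :: "'i set \<Rightarrow> ('i \<Rightarrow> real) set" where
  "fin_supp_nonneg T = {l. (\<forall>t. 0 \<le> l t) \<and> supp l \<subseteq> T \<and> finite (supp l)}"

definition D_values :: "real^'n \<Rightarrow> ('i \<Rightarrow> real^'n) \<Rightarrow> ('i \<Rightarrow> real) \<Rightarrow> 'i set \<Rightarrow> real set" where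
  "D_values c a b T =
     {- (\<Sum>t\<in>supp l. l t * b t) | l.
        l \<in> fin_supp_nonneg T \<and> (\<Sum>t\<in>supp l. l t *\<^sub>R a t) = - c}"

definition sup_value :: "real set \<Rightarrow> ereal" where
  "sup_value V = (SUP v\<in>V. ereal v)"

definition is_max_value :: "real \<Rightarrow> real set \<Rightarrow> bool" where
  "is_max_value \<alpha> V \<longleftrightarrow> ereal \<alpha> = sup_value V \<and> (\<exists>v\<in>V. ereal v = sup_value V)"

definition P_reducible ::
  "real^'n \<Rightarrow> ('i \<Rightarrow> real^'n) \<Rightarrow> ('i \<Rightarrow> real) \<Rightarrow> 'i set \<Rightarrow> 'i set set \<Rightarrow> bool" where
  "P_reducible c a b T \<H> \<longleftrightarrow> (\<exists>H\<in>\<H>. inf_P c a b T = inf_P c a b H)"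

definition D_reducible ::
  "real^'n \<Rightarrow> ('i \<Rightarrow> real^'n) \<Rightarrow> ('i \<Rightarrow> real) \<Rightarrow> 'i set \<Rightarrow> 'i set set \<Rightarrow> bool" where
  "D_reducible c a b T \<H> \<longleftrightarrow>
     (\<exists>H\<in>\<H>. sup_value (D_values c a b T) = sup_value (DH_values c a b H))"

end

theory Submission imports Defs begin

text \<open>
  All five statements say the same thing about a single index set: some \<open>H \<in> \<H>\<close> carries a
  feasible multiplier vector of \<open>(D\<^sub>H)\<close> whose value is exactly \<open>\<alpha>\<close>. Two facts about problems
  with constraint set \<open>H\<close> give this.

  Weak duality bounds every value of \<open>(D\<^sub>H)\<close> by \<open>inf (P\<^sub>H)\<close>, and \<open>inf (P\<^sub>H) \<le> inf (P) = \<alpha>\<close>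
  since \<open>(P\<^sub>H)\<close> has fewer constraints. The values of \<open>(D\<^sub>\<H>)\<close> and of \<open>(D)\<close> are unions of the
  values of \<open>(D\<^sub>H)\<close>, over \<open>H \<in> \<H>\<close> and over all finite \<open>H \<subseteq> T\<close>. Hence \<open>\<alpha>\<close> is an
  upper bound for all of them, and a maximum equal to \<open>\<alpha>\<close> just means that \<open>\<alpha>\<close> is one of the
  values. If it is a value of \<open>(D\<^sub>H)\<close>, then \<open>sup (D\<^sub>H)\<close>, \<open>sup (D)\<close> and \<open>inf (P\<^sub>H)\<close> are
  squeezed onto \<open>\<alpha>\<close>, which gives both kinds of reducibility.

  Conversely, reducibility of \<open>(P)\<close>, as well as reducibility of \<open>(D)\<close> together with zero duality,
  makes \<open>inf (P\<^sub>H)\<close> equal to the finite number \<open>\<alpha>\<close> for some finite \<open>H \<in> \<H>\<close>, and the strong duality theorem of finite linear programming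
  (\<open>finite_lp_dual_attainment\<close>) produces the multipliers. It is obtained by separating
  \<open>- (c, \<alpha>)\<close> from a finitely generated, hence closed, convex cone.

  The cone condition is membership of \<open>- (c, \<alpha>)\<close> in a cone of points
  \<open>\<Sum>t\<in>H. \<mu> t *\<^sub>R (a t, b t)\<close> raised in the last coordinate by some \<open>r \<ge> 0\<close>. Weak duality forces
  \<open>r = 0\<close>. Finally, if \<open>\<H>\<close> is directed and covers \<open>T\<close>, the finite support of a multiplier in
  \<open>(D)\<close> is contained in a member of \<open>\<H>\<close>, so \<open>(D)\<close> and \<open>(D\<^sub>\<H>)\<close> have the same values.
\<close>

section \<open>Dual values and weak duality\<close>

lemma DF_values_eq_Union: "DF_values c a b \<H> = (\<Union>H\<in>\<H>. DH_values c a b H)"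
  unfolding DF_values_def DH_values_def by blast

lemma DH_values_mono:
  assumes "finite K" "H \<subseteq> K"
  shows "DH_values c a b H \<subseteq> DH_values c a b K"
proof
  fix v assume "v \<in> DH_values c a b H"
  then obtain \<mu> where \<mu>: "\<forall>t\<in>H. 0 \<le> \<mu> t" "(\<Sum>t\<in>H. \<mu> t *\<^sub>R a t) = - c"
    and v: "v = - (\<Sum>t\<in>H. \<mu> t * b t)"
    unfolding DH_values_def by blast
  define \<nu> where "\<nu> t = (if t \<in> H then \<mu> t else 0)" for t
  have "(\<Sum>t\<in>K. \<nu> t *\<^sub>R a t) = (\<Sum>t\<in>H. \<mu> t *\<^sub>R a t)"
    using assms by (intro sum.mono_neutral_cong_right) (auto simp: \<nu>_def)
  moreover have "(\<Sum>t\<in>K. \<nu> t * b t) = (\<Sum>t\<in>H. \<mu> t * b t)"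
    using assms by (intro sum.mono_neutral_cong_right) (auto simp: \<nu>_def)
  moreover have "\<forall>t\<in>K. 0 \<le> \<nu> t"
    using \<mu>(1) by (simp add: \<nu>_def)
  ultimately show "v \<in> DH_values c a b K"
    unfolding DH_values_def using \<mu>(2) v by (intro CollectI exI[of _ \<nu>]) simp
qed

text \<open>
  A finitely supported multiplier is a multiplier on its own support, and a multiplier on a
  finite \<open>H\<close> extends by zero. The empty \<open>H\<close> occurs here, as the support of the zero multiplier.
\<close>

lemma D_values_eq_Union: "D_values c a b T = (\<Union>H\<in>{H. H \<subseteq> T \<and> finite H}. DH_values c a b H)"
proof (intro equalityI subsetI)
  fix v assume "v \<in> D_values c a b T"
  then obtain l where "l \<in> fin_supp_nonneg T" "(\<Sum>t\<in>supp l. l t *\<^sub>R a t) = - c"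
    "v = - (\<Sum>t\<in>supp l. l t * b t)"
    unfolding D_values_def by blast
  then have "supp l \<subseteq> T" "finite (supp l)" "v \<in> DH_values c a b (supp l)"
    unfolding DH_values_def fin_supp_nonneg_def by blast+
  then show "v \<in> (\<Union>H\<in>{H. H \<subseteq> T \<and> finite H}. DH_values c a b H)"
    by blast
next
  fix v assume "v \<in> (\<Union>H\<in>{H. H \<subseteq> T \<and> finite H}. DH_values c a b H)"
  then obtain H \<mu> where H: "H \<subseteq> T" "finite H"
    and \<mu>: "\<forall>t\<in>H. 0 \<le> \<mu> t" "(\<Sum>t\<in>H. \<mu> t *\<^sub>R a t) = - c"
    and v: "v = - (\<Sum>t\<in>H. \<mu> t * b t)"
    unfolding DH_values_def by blast
  define l where "l t = (if t \<in> H then \<mu> t else 0)" for t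
  have supp: "supp l \<subseteq> H"
    by (auto simp: supp_def l_def)
  have "(\<Sum>t\<in>supp l. l t *\<^sub>R a t) = (\<Sum>t\<in>H. \<mu> t *\<^sub>R a t)"
    using H(2) supp by (intro sum.mono_neutral_cong_left) (auto simp: l_def supp_def)
  moreover have "(\<Sum>t\<in>supp l. l t * b t) = (\<Sum>t\<in>H. \<mu> t * b t)"
    using H(2) supp by (intro sum.mono_neutral_cong_left) (auto simp: l_def supp_def)
  moreover have "l \<in> fin_supp_nonneg T"
    using \<mu>(1) H supp finite_subset[OF supp] by (auto simp: fin_supp_nonneg_def l_def)
  ultimately show "v \<in> D_values c a b T"
    unfolding D_values_def using \<mu>(2) v by (intro CollectI exI[of _ l]) simp
qed

lemma D_values_eq_DF_values_of_directed_covering: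
  assumes "\<H> \<noteq> {}" "\<H> \<subseteq> \<F> T" "directed \<H>" "covering T \<H>"
  shows "D_values c a b T = DF_values c a b \<H>"
proof -
  have absorb: "\<exists>L\<in>\<H>. F \<subseteq> L" if "finite F" "F \<subseteq> T" for F
    using that
  proof (induction F)
    case empty
    then show ?case using assms(1) by blast
  next
    case (insert t F)
    then obtain L where "L \<in> \<H>" "F \<subseteq> L" by auto
    moreover obtain K where "K \<in> \<H>" "t \<in> K"
      using insert.prems assms(4) unfolding covering_def by auto
    ultimately obtain M where "M \<in> \<H>" "L \<union> K \<subseteq> M"
      using assms(3) unfolding directed_def by blast
    then show ?case using \<open>F \<subseteq> L\<close> \<open>t \<in> K\<close> by blast
  qed
  have fin: "finite H \<and> H \<subseteq> T" if "H \<in> \<H>" for H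
    using assms(2) that by (auto simp: nonempty_finite_subsets_def)
  show ?thesis
    unfolding D_values_eq_Union DF_values_eq_Union
  proof (intro equalityI subsetI)
    fix v assume "v \<in> (\<Union>H\<in>{H. H \<subseteq> T \<and> finite H}. DH_values c a b H)"
    then obtain F where F: "F \<subseteq> T" "finite F" "v \<in> DH_values c a b F" by blast
    then obtain L where L: "L \<in> \<H>" "F \<subseteq> L" using absorb by blast
    then show "v \<in> (\<Union>H\<in>\<H>. DH_values c a b H)"
      using DH_values_mono[of L F c a b] fin F(3) by blast
  qed (use fin in blast)
qed

lemma primal_weak_duality:
  assumes "v \<in> DH_values c a b H" "x \<in> primal_feasible a b H"
  shows "v \<le> c \<bullet> x"
proof -
  obtain \<mu> where \<mu>: "\<forall>t\<in>H. 0 \<le> \<mu> t" "(\<Sum>t\<in>H. \<mu> t *\<^sub>R a t) = - c"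
    and v: "v = - (\<Sum>t\<in>H. \<mu> t * b t)"
    using assms(1) unfolding DH_values_def by blast
  have "- (c \<bullet> x) = (\<Sum>t\<in>H. \<mu> t * (a t \<bullet> x))"
    using arg_cong[OF \<mu>(2), of "\<lambda>y. y \<bullet> x"] by (simp add: inner_sum_left)
  also have "\<dots> \<le> (\<Sum>t\<in>H. \<mu> t * b t)"
    using \<mu>(1) assms(2) by (intro sum_mono mult_left_mono) (auto simp: primal_feasible_def)
  finally show ?thesis using v by simp
qed

lemma DH_value_le_inf_P: "v \<in> DH_values c a b H \<Longrightarrow> ereal v \<le> inf_P c a b H"
  unfolding inf_P_def by (intro INF_greatest) (simp add: primal_weak_duality)

lemma inf_P_antimono: "H \<subseteq> K \<Longrightarrow> inf_P c a b H \<le> inf_P c a b K"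
  unfolding inf_P_def primal_feasible_def by (intro INF_superset_mono) auto

lemma is_max_value_iff: "is_max_value \<alpha> V \<longleftrightarrow> \<alpha> \<in> V \<and> (\<forall>v\<in>V. v \<le> \<alpha>)"
proof
  assume "is_max_value \<alpha> V"
  then show "\<alpha> \<in> V \<and> (\<forall>v\<in>V. v \<le> \<alpha>)"
    unfolding is_max_value_def sup_value_def by (metis SUP_upper ereal.inject ereal_less_eq(3))
next
  assume *: "\<alpha> \<in> V \<and> (\<forall>v\<in>V. v \<le> \<alpha>)"
  then have "sup_value V = ereal \<alpha>"
    unfolding sup_value_def by (intro antisym SUP_least SUP_upper2[of \<alpha>]) auto
  then show "is_max_value \<alpha> V"
    using * by (auto simp: is_max_value_def)
qed

section \<open>The cone of constraint consequences and finite strong duality\<close>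

text \<open>
  The cone spanned by the constraints in \<open>H\<close> and the vertical ray \<open>(0, 1)\<close>: an element
  \<open>(y, \<beta>)\<close> stands for a linear inequality \<open>y \<bullet> x \<le> \<beta>\<close> obtained from the constraints
  by combining them and weakening the right-hand side.
\<close>

definition consequence_cone :: "('i \<Rightarrow> real^'n) \<Rightarrow> ('i \<Rightarrow> real) \<Rightarrow> 'i set \<Rightarrow> ((real^'n) \<times> real) set"
  where "consequence_cone a b H =
    {(\<Sum>t\<in>H. \<mu> t *\<^sub>R a t, (\<Sum>t\<in>H. \<mu> t * b t) + r) | \<mu> r. (\<forall>t\<in>H. 0 \<le> \<mu> t) \<and> 0 \<le> r}"

lemma consequence_coneI:
  assumes "\<And>t. t \<in> H \<Longrightarrow> 0 \<le> \<mu> t" "0 \<le> r"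
    "y = (\<Sum>t\<in>H. \<mu> t *\<^sub>R a t)" "\<beta> = (\<Sum>t\<in>H. \<mu> t * b t) + r"
  shows "(y, \<beta>) \<in> consequence_cone a b H"
  unfolding consequence_cone_def using assms by blast

lemma convex_cone_consequence_cone: "convex_cone (consequence_cone a b H)"
  unfolding convex_cone_iff
proof (intro conjI ballI allI impI)
  show "0 \<in> consequence_cone a b H"
    unfolding zero_prod_def by (rule consequence_coneI[where \<mu> = "\<lambda>_. 0" and r = 0]) auto
next
  fix p q assume "p \<in> consequence_cone a b H" "q \<in> consequence_cone a b H"
  then obtain \<mu> r \<nu> s where
    p: "p = (\<Sum>t\<in>H. \<mu> t *\<^sub>R a t, (\<Sum>t\<in>H. \<mu> t * b t) + r)" "\<forall>t\<in>H. 0 \<le> \<mu> t" "0 \<le> r" and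
    q: "q = (\<Sum>t\<in>H. \<nu> t *\<^sub>R a t, (\<Sum>t\<in>H. \<nu> t * b t) + s)" "\<forall>t\<in>H. 0 \<le> \<nu> t" "0 \<le> s"
    unfolding consequence_cone_def by blast
  show "p + q \<in> consequence_cone a b H"
    unfolding p(1) q(1) add_Pair
    by (rule consequence_coneI[where \<mu> = "\<lambda>t. \<mu> t + \<nu> t" and r = "r + s"])
      (use p q in \<open>auto simp: sum.distrib algebra_simps\<close>)
next
  fix p and k :: real assume "p \<in> consequence_cone a b H" "0 \<le> k"
  then obtain \<mu> r where
    p: "p = (\<Sum>t\<in>H. \<mu> t *\<^sub>R a t, (\<Sum>t\<in>H. \<mu> t * b t) + r)" "\<forall>t\<in>H. 0 \<le> \<mu> t" "0 \<le> r"
    unfolding consequence_cone_def by blast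
  show "k *\<^sub>R p \<in> consequence_cone a b H"
    unfolding p(1) scaleR_Pair
    by (rule consequence_coneI[where \<mu> = "\<lambda>t. k * \<mu> t" and r = "k * r"])
      (use p \<open>0 \<le> k\<close> in \<open>auto simp: scaleR_sum_right sum_distrib_left algebra_simps\<close>)
qed

lemma raised_constraint_in_consequence_cone:
  assumes "finite H" "t \<in> H" "0 \<le> r"
  shows "(a t, b t + r) \<in> consequence_cone a b H"
proof (rule consequence_coneI)
  let ?\<mu> = "\<lambda>s. if s = t then 1 else 0 :: real"
  have "(\<Sum>s\<in>H. ?\<mu> s *\<^sub>R a s) = (\<Sum>s\<in>{t}. a s)"
    using assms by (intro sum.mono_neutral_cong_right) auto
  then show "a t = (\<Sum>s\<in>H. ?\<mu> s *\<^sub>R a s)" by simp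
  have "(\<Sum>s\<in>H. ?\<mu> s * b s) = (\<Sum>s\<in>{t}. b s)"
    using assms by (intro sum.mono_neutral_cong_right) auto
  then show "b t + r = (\<Sum>s\<in>H. ?\<mu> s * b s) + r" by simp
qed (use assms in auto)

lemma dual_value_ge_of_consequence:
  assumes "- (c, \<alpha>) \<in> consequence_cone a b H"
  obtains v where "v \<in> DH_values c a b H" "\<alpha> \<le> v"
proof -
  obtain \<mu> r where \<mu>: "\<forall>t\<in>H. 0 \<le> \<mu> t" "0 \<le> r"
    and eq: "- c = (\<Sum>t\<in>H. \<mu> t *\<^sub>R a t)" "- \<alpha> = (\<Sum>t\<in>H. \<mu> t * b t) + r"
    using assms unfolding consequence_cone_def by auto
  have "- (\<Sum>t\<in>H. \<mu> t * b t) \<in> DH_values c a b H"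
    unfolding DH_values_def using \<mu>(1) eq(1)[symmetric] by blast
  then show thesis using that eq(2) \<mu>(2) by force
qed

text \<open>
  This carries strong duality for finite linear programs. If the claim fails, a hyperplane separating
  \<open>- (c, \<alpha>)\<close> from the closed cone spanned by the constraints and the vertical ray has a normal
  \<open>(u, s)\<close> with \<open>s \<ge> 0\<close>, \<open>u \<bullet> a t + s * b t \<ge> 0\<close> and \<open>u \<bullet> c + s * \<alpha> > 0\<close>. If \<open>s > 0\<close> then
  \<open>- u / s\<close> is feasible with a value below \<open>\<alpha>\<close>; if \<open>s = 0\<close> then \<open>- u\<close> is a feasible direction
  along which the objective is unbounded. Starting from a feasible \<open>x\<close>, the points
  \<open>(x - k u) / (1 + k s)\<close> with large \<open>k\<close> treat both cases at once.
\<close>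

lemma finite_lp_consequence:
  assumes fin: "finite H" and inf: "inf_P c a b H = ereal \<alpha>"
  shows "- (c, \<alpha>) \<in> consequence_cone a b H"
proof (rule ccontr)
  define G where "G = insert (0, 1) ((\<lambda>t. (a t, b t)) ` H)"
  define C where "C = convex_cone hull G"
  have C: "closed C" "convex_cone C"
    unfolding C_def using fin
    by (simp_all add: G_def closed_convex_cone_hull convex_cone_convex_cone_hull)
  have "(0, 1) \<in> consequence_cone a b H"
    by (rule consequence_coneI[where \<mu> = "\<lambda>_. 0" and r = 1]) auto
  then have "C \<subseteq> consequence_cone a b H"
    unfolding C_def G_def
    using raised_constraint_in_consequence_cone[OF fin, of _ 0 a b] convex_cone_consequence_cone
    by (intro hull_minimal) auto
  moreover assume "- (c, \<alpha>) \<notin> consequence_cone a b H"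
  ultimately have "- (c, \<alpha>) \<notin> C" by blast
  moreover have "convex C"
    using C(2) by (simp add: convex_cone_def)
  ultimately obtain p \<beta> where p: "p \<bullet> - (c, \<alpha>) < \<beta>" "\<And>z. z \<in> C \<Longrightarrow> \<beta> < p \<bullet> z"
    using separating_hyperplane_closed_point[of C "- (c, \<alpha>)"] C(1) by blast
  have "\<beta> < 0"
    using p(2)[of 0] convex_cone_contains_0[OF C(2)] by simp
  have nonneg: "0 \<le> p \<bullet> z" if "z \<in> C" for z
  proof (rule ccontr)
    assume neg: "\<not> 0 \<le> p \<bullet> z"
    \<comment> \<open>Rescaling \<open>z\<close> inside the cone puts it exactly on the hyperplane.\<close>
    have "(\<beta> / (p \<bullet> z)) *\<^sub>R z \<in> C"
      using neg \<open>\<beta> < 0\<close> that C(2) by (intro convex_cone_scaleR) (auto simp: divide_nonpos_neg)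
    from p(2)[OF this] show False using neg by simp
  qed
  obtain u s where us: "p = (u, s)" by (cases p)
  have "G \<subseteq> C" unfolding C_def by (rule hull_subset)
  then have s: "0 \<le> s" and gen: "\<And>t. t \<in> H \<Longrightarrow> 0 \<le> u \<bullet> a t + s * b t"
    using nonneg[of "(0, 1)"] nonneg[of "(a _, b _)"] by (auto simp: G_def us)
  have sep: "0 < u \<bullet> c + s * \<alpha>"
    using p(1) \<open>\<beta> < 0\<close> by (simp add: us)
  have "primal_feasible a b H \<noteq> {}"
    using inf by (auto simp: inf_P_def top_ereal_def)
  then obtain x where x: "x \<in> primal_feasible a b H" by blast
  define k where "k = (\<bar>c \<bullet> x - \<alpha>\<bar> + 1) / (u \<bullet> c + s * \<alpha>)"
  have k: "0 \<le> k" "c \<bullet> x - \<alpha> < k * (u \<bullet> c + s * \<alpha>)"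
    using sep by (auto simp: k_def)
  define d where "d = 1 + k * s"
  have d: "0 < d" using k(1) s by (simp add: d_def add_pos_nonneg)
  define w where "w = (1 / d) *\<^sub>R (x - k *\<^sub>R u)"
  have "a t \<bullet> w \<le> b t" if "t \<in> H" for t
  proof -
    have "a t \<bullet> x \<le> b t" using x that by (simp add: primal_feasible_def)
    moreover have "0 \<le> k * (u \<bullet> a t + s * b t)" using k(1) gen[OF that] by simp
    ultimately have "a t \<bullet> x - k * (a t \<bullet> u) \<le> b t * d"
      by (simp add: d_def algebra_simps inner_commute)
    then show ?thesis
      using d by (simp add: w_def inner_diff_right pos_divide_le_eq)
  qed
  then have "w \<in> primal_feasible a b H" by (simp add: primal_feasible_def)
  then have "ereal \<alpha> \<le> ereal (c \<bullet> w)"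
    unfolding inf[symmetric] inf_P_def by (rule INF_lower)
  moreover have "c \<bullet> x - k * (c \<bullet> u) < \<alpha> * d"
    using k(2) by (simp add: d_def algebra_simps inner_commute)
  then have "c \<bullet> w < \<alpha>"
    using d by (simp add: w_def inner_diff_right pos_divide_less_eq)
  ultimately show False by simp
qed

lemma finite_lp_dual_attainment:
  assumes "finite H" "inf_P c a b H = ereal \<alpha>"
  shows "\<alpha> \<in> DH_values c a b H"
proof -
  obtain v where v: "v \<in> DH_values c a b H" "\<alpha> \<le> v"
    using dual_value_ge_of_consequence[OF finite_lp_consequence[OF assms]] .
  moreover have "v \<le> \<alpha>"
    using DH_value_le_inf_P[OF v(1)] assms(2) by simp
  ultimately show ?thesis by simp
qed

section \<open>The cone condition\<close>

lemma gen_cone_eq_convex_cone_hull: "A \<noteq> {} \<Longrightarrow> gen_cone A = convex_cone hull A"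
  unfolding gen_cone_def convex_cone_hull_convex_hull_nonempty by blast

text \<open>
  The two cones differ at most on the vertical axis: the consequence cone contains the whole ray
  \<open>{0} \<times> {0..}\<close>, whereas a point of the cone on the left with all multipliers zero is the origin.
\<close>

lemma gen_cone_subset_consequence_cone:
  assumes "finite H" "H \<noteq> {}"
  shows "gen_cone ((\<lambda>t. (a t, b t)) ` H + {0} \<times> {0..}) \<subseteq> consequence_cone a b H"
proof -
  let ?A = "(\<lambda>t. (a t, b t)) ` H + {0} \<times> {0..}"
  have "?A \<subseteq> consequence_cone a b H"
    using raised_constraint_in_consequence_cone[OF assms(1)] by (auto simp: set_plus_def)
  moreover have "?A \<noteq> {}"
    using assms(2) by (auto simp: set_plus_def)
  ultimately show ?thesis
    by (simp add: gen_cone_eq_convex_cone_hull hull_minimal convex_cone_consequence_cone)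
qed

lemma sum_constraints_in_gen_cone:
  fixes a :: "'i \<Rightarrow> real^'n" and b :: "'i \<Rightarrow> real"
  assumes "H \<noteq> {}" "\<forall>t\<in>H. 0 \<le> \<mu> t"
  shows "(\<Sum>t\<in>H. \<mu> t *\<^sub>R (a t, b t)) \<in> gen_cone ((\<lambda>t. (a t, b t)) ` H + {0} \<times> {0..})"
proof -
  let ?A = "(\<lambda>t. (a t, b t)) ` H + {0} \<times> {0..}"
  have A: "(a t, b t) \<in> ?A" if "t \<in> H" for t
  proof -
    have "(a t, b t) + (0, 0) \<in> ?A"
      using that by (intro set_plus_intro imageI) auto
    then show ?thesis by simp
  qed
  then have "?A \<noteq> {}" using assms(1) by blast
  moreover have "(\<Sum>t\<in>F. \<mu> t *\<^sub>R (a t, b t)) \<in> convex_cone hull ?A" if "F \<subseteq> H" for F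
    using that
  proof (induction F rule: infinite_finite_induct)
    case (insert t F)
    then have t: "t \<in> H" and F: "(\<Sum>s\<in>F. \<mu> s *\<^sub>R (a s, b s)) \<in> convex_cone hull ?A"
      by blast+
    have "\<mu> t *\<^sub>R (a t, b t) \<in> convex_cone hull ?A"
      using t assms(2) by (intro convex_cone_hull_mul hull_inc A) auto
    from convex_cone_hull_add[OF this F] show ?case
      unfolding sum.insert[OF insert.hyps] .
  qed (simp_all add: convex_cone_hull_contains_0)
  ultimately show ?thesis
    by (simp add: gen_cone_eq_convex_cone_hull)
qed

lemma K_cone_iff_dual_value:
  assumes "\<H> \<subseteq> \<F> T" "inf_P c a b T = ereal \<alpha>"
  shows "- (c, \<alpha>) \<in> K_cone a b \<H> \<longleftrightarrow> \<alpha> \<in> DF_values c a b \<H>"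
proof
  assume "- (c, \<alpha>) \<in> K_cone a b \<H>"
  then obtain H where H: "H \<in> \<H>"
    and mem: "- (c, \<alpha>) \<in> gen_cone ((\<lambda>t. (a t, b t)) ` H + {0} \<times> {0..})"
    unfolding K_cone_def by blast
  have HT: "finite H" "H \<noteq> {}" "H \<subseteq> T"
    using H assms(1) by (auto simp: nonempty_finite_subsets_def)
  obtain v where v: "v \<in> DH_values c a b H" "\<alpha> \<le> v"
    using dual_value_ge_of_consequence gen_cone_subset_consequence_cone[OF HT(1,2)] mem by blast
  have "ereal v \<le> ereal \<alpha>"
    using order_trans[OF DH_value_le_inf_P[OF v(1)] inf_P_antimono[OF HT(3)]] assms(2) by simp
  then have "v = \<alpha>" using v(2) by simp
  then show "\<alpha> \<in> DF_values c a b \<H>"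
    unfolding DF_values_eq_Union using v(1) H by blast
next
  assume "\<alpha> \<in> DF_values c a b \<H>"
  then obtain H \<mu> where H: "H \<in> \<H>" and \<mu>: "\<forall>t\<in>H. 0 \<le> \<mu> t"
    and eq: "(\<Sum>t\<in>H. \<mu> t *\<^sub>R a t) = - c" "\<alpha> = - (\<Sum>t\<in>H. \<mu> t * b t)"
    unfolding DF_values_def by blast
  have "H \<noteq> {}" using H assms(1) by (auto simp: nonempty_finite_subsets_def)
  moreover have "(\<Sum>t\<in>H. \<mu> t *\<^sub>R (a t, b t)) = - (c, \<alpha>)"
    using eq by (simp add: prod_eq_iff fst_sum snd_sum)
  ultimately have "- (c, \<alpha>) \<in> gen_cone ((\<lambda>t. (a t, b t)) ` H + {0} \<times> {0..})"
    using sum_constraints_in_gen_cone[of H \<mu> a b] \<mu> by simp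
  then show "- (c, \<alpha>) \<in> K_cone a b \<H>"
    unfolding K_cone_def using H by blast
qed

section \<open>Equivalence of the duality statements\<close>

theorem corollary4p2:
  fixes T :: "'i set" and c :: "real^'n" and a :: "'i \<Rightarrow> real^'n" and b :: "'i \<Rightarrow> real"
    and \<H> :: "'i set set" and \<alpha> :: real
  assumes "infinite T" and "\<H> \<noteq> {}" and "\<H> \<subseteq> \<F> T" and "inf_P c a b T = ereal \<alpha>"
  shows
    "(- (c, \<alpha>) \<in> K_cone a b \<H> \<longleftrightarrow> is_max_value \<alpha> (DF_values c a b \<H>))
     \<and> (is_max_value \<alpha> (DF_values c a b \<H>) \<longleftrightarrow>
          D_reducible c a b T \<H> \<and> ereal \<alpha> = sup_value (DF_values c a b \<H>))
     \<and> (D_reducible c a b T \<H> \<and> ereal \<alpha> = sup_value (DF_values c a b \<H>) \<longleftrightarrow>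
          P_reducible c a b T \<H>)
     \<and> (ereal \<alpha> = sup_value (DF_values c a b \<H>) \<longrightarrow> ereal \<alpha> = sup_value (D_values c a b T))
     \<and> (directed \<H> \<and> covering T \<H> \<longrightarrow>
          (P_reducible c a b T \<H> \<longleftrightarrow> is_max_value \<alpha> (D_values c a b T)))"
proof -
  have member: "finite H" "H \<subseteq> T" if "H \<in> \<H>" for H
    using assms(3) that by (auto simp: nonempty_finite_subsets_def)
  have DH_le_inf: "sup_value (DH_values c a b H) \<le> inf_P c a b H" for H
    unfolding sup_value_def by (intro SUP_least DH_value_le_inf_P)
  have inf_le: "inf_P c a b H \<le> ereal \<alpha>" if "H \<subseteq> T" for H
    using inf_P_antimono[OF that, of c a b] assms(4) by simp
  have D_le: "v \<le> \<alpha>" if v: "v \<in> D_values c a b T" for v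
  proof -
    obtain H where H: "H \<subseteq> T" "v \<in> DH_values c a b H"
      using v unfolding D_values_eq_Union by blast
    show ?thesis
      using order_trans[OF DH_value_le_inf_P[OF H(2)] inf_le[OF H(1)]] by simp
  qed
  have DF_sub: "DF_values c a b \<H> \<subseteq> D_values c a b T"
    unfolding DF_values_eq_Union D_values_eq_Union using member by blast
  have sup_D: "ereal \<alpha> = sup_value (D_values c a b T)"
    if "ereal \<alpha> = sup_value (DF_values c a b \<H>)"
  proof (rule antisym)
    show "ereal \<alpha> \<le> sup_value (D_values c a b T)"
      unfolding that sup_value_def using DF_sub by (intro SUP_subset_mono) auto
    show "sup_value (D_values c a b T) \<le> ereal \<alpha>"
      unfolding sup_value_def by (intro SUP_least) (simp add: D_le)
  qed
  have max_iff: "is_max_value \<alpha> (DF_values c a b \<H>) \<longleftrightarrow> \<alpha> \<in> DF_values c a b \<H>"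
    using D_le DF_sub by (auto simp: is_max_value_iff)
  have max_D_iff: "is_max_value \<alpha> (D_values c a b T) \<longleftrightarrow> \<alpha> \<in> D_values c a b T"
    using D_le by (auto simp: is_max_value_iff)
  have i_ii: "- (c, \<alpha>) \<in> K_cone a b \<H> \<longleftrightarrow> \<alpha> \<in> DF_values c a b \<H>"
    using K_cone_iff_dual_value assms(3,4) .
  have ii_iii: "D_reducible c a b T \<H> \<and> ereal \<alpha> = sup_value (DF_values c a b \<H>)"
    if val: "\<alpha> \<in> DF_values c a b \<H>"
  proof -
    obtain H where H: "H \<in> \<H>" "\<alpha> \<in> DH_values c a b H"
      using val unfolding DF_values_eq_Union by blast
    have "ereal \<alpha> = sup_value (DF_values c a b \<H>)"
      using val max_iff by (simp add: is_max_value_def)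
    moreover have "sup_value (DH_values c a b H) = ereal \<alpha>"
      using order_trans[OF DH_le_inf inf_le[OF member(2)[OF H(1)]]] H(2)
      by (intro antisym) (auto simp: sup_value_def intro: SUP_upper)
    ultimately show ?thesis
      using sup_D H(1) unfolding D_reducible_def by (intro conjI bexI[of _ H]) simp_all
  qed
  have iii_iv: "P_reducible c a b T \<H>"
    if red: "D_reducible c a b T \<H>" and zero: "ereal \<alpha> = sup_value (DF_values c a b \<H>)"
  proof -
    obtain H where H: "H \<in> \<H>" "sup_value (D_values c a b T) = sup_value (DH_values c a b H)"
      using red unfolding D_reducible_def by blast
    then have "inf_P c a b H = ereal \<alpha>"
      using sup_D[OF zero] DH_le_inf[of H] inf_le[OF member(2)[OF H(1)]] by simp
    then show ?thesis
      unfolding P_reducible_def assms(4) using H(1) by (intro bexI[of _ H]) simp_all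
  qed
  have iv_ii: "\<alpha> \<in> DF_values c a b \<H>" if red: "P_reducible c a b T \<H>"
  proof -
    obtain H where H: "H \<in> \<H>" "inf_P c a b H = ereal \<alpha>"
      using red unfolding P_reducible_def assms(4) by (auto dest: sym)
    show ?thesis
      unfolding DF_values_eq_Union
      by (rule UN_I, rule H(1), rule finite_lp_dual_attainment[OF member(1)[OF H(1)] H(2)])
  qed
  have v: "D_values c a b T = DF_values c a b \<H>" if "directed \<H> \<and> covering T \<H>"
    using D_values_eq_DF_values_of_directed_covering[OF assms(2,3)] that by simp
  have iv_iff: "P_reducible c a b T \<H> \<longleftrightarrow> \<alpha> \<in> DF_values c a b \<H>"
    using ii_iii iii_iv iv_ii by blast
  show ?thesis
    unfolding max_iff max_D_iff i_ii
  proof (intro conjI impI)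
    assume "directed \<H> \<and> covering T \<H>"
    then show "P_reducible c a b T \<H> \<longleftrightarrow> \<alpha> \<in> D_values c a b T"
      using iv_iff v by simp
  qed (use ii_iii iii_iv iv_ii sup_D in blast)+
qed

end
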